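(* Let $\mathcal H$ be a real Hilbert space, let $\mu\in\,]0,\infty[$, let $n\ge 1$ be an integer, $I=\{1,\dots,n\}$, and let $\lambda_i>0$ ($i\in I$) satisfy $\sum_{i\in I}\lambda_i=1$. For each $i\in I$ let $A_i:\mathcal H\rightrightarrows\mathcal H$ be maximally monotone, and write $\mathbf A=(A_1,\dots,A_n)$, $\boldsymbol\lambda=(\lambda_1,\dots,\lambda_n)$. If there exists $i_0\in I$ such that $A_{i_0}$ is disjointly injective, then $\mathcal R_\mu(\mathbf A,\boldsymbol\lambda)$ is disjointly injective.
   Context: A mapping $A:\mathcal H\rightrightarrows\mathcal H$ is disjointly injective if for any two distinct points $x,y\in\mathcal H$, $Ax\cap Ay=\varnothing$. $A^{-1}$ is the set-valued mapping with $x\in A^{-1}u\Leftrightarrow u\in Ax$. Sums and scalar multiples of set-valued mappings are pointwise Minkowski operations; $\mathrm{Id}$ is the identity. The $\boldsymbol\lambda$-weighted resolvent average of $\mathbf A$ with parameter $\mu$ is the set-valued mapping $$\mathcal R_\mu(\mathbf A,\boldsymbol\lambda)=\Big(\sum_{i\in I}\lambda_i(A_i+\mu^{-1}\mathrm{Id})^{-1}\Big)^{-1}-\mu^{-1}\mathrm{Id}.$$ *)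

theory Defs
  imports "HOL-Analysis.Analysis" "HOL-Library.Set_Algebras"
begin

text \<open>
  A real Hilbert space is a type of sort \<open>{real_inner, complete_space}\<close>; a set-valued
  mapping on it is a function \<open>'a \<Rightarrow> 'a set\<close>.  On sets, \<open>+\<close> and \<open>\<Sum>\<close> are the Minkowski
  operations of \<^theory>\<open>HOL-Library.Set_Algebras\<close> (so a sum with an empty summand is empty),
  whereas \<open>-\<close> is set difference; subtraction of mappings is therefore written as addition
  of the multiple by \<open>-1\<close>.
\<close>

type_synonym 'a svmap = "'a \<Rightarrow> 'a set"

definition sv_graph :: "'a svmap \<Rightarrow> ('a \<times> 'a) set"
  where "sv_graph A = {(x, u). u \<in> A x}"

definition sv_inverse :: "'a svmap \<Rightarrow> 'a svmap"
  where "sv_inverse A = (\<lambda>u. {x. u \<in> A x})"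

definition sv_id :: "'a svmap"
  where "sv_id = (\<lambda>x. {x})"

definition sv_plus :: "'a::plus svmap \<Rightarrow> 'a svmap \<Rightarrow> 'a svmap"
  where "sv_plus A B = (\<lambda>x. A x + B x)"

definition sv_scale :: "real \<Rightarrow> 'a::real_vector svmap \<Rightarrow> 'a svmap"
  where "sv_scale c A = (\<lambda>x. (\<lambda>u. c *\<^sub>R u) ` A x)"

definition sv_minus :: "'a::real_vector svmap \<Rightarrow> 'a svmap \<Rightarrow> 'a svmap"
  where "sv_minus A B = sv_plus A (sv_scale (- 1) B)"

definition sv_sum :: "('i \<Rightarrow> 'a::comm_monoid_add svmap) \<Rightarrow> 'i set \<Rightarrow> 'a svmap"
  where "sv_sum A I = (\<lambda>x. \<Sum>i\<in>I. A i x)"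

definition sv_monotone :: "'a::real_inner svmap \<Rightarrow> bool"
  where "sv_monotone A \<longleftrightarrow>
    (\<forall>(x, u) \<in> sv_graph A. \<forall>(y, v) \<in> sv_graph A. inner (x - y) (u - v) \<ge> 0)"

definition maximally_monotone :: "'a::real_inner svmap \<Rightarrow> bool"
  where "maximally_monotone A \<longleftrightarrow> sv_monotone A \<and>
    (\<forall>B. sv_monotone B \<and> sv_graph A \<subseteq> sv_graph B \<longrightarrow> sv_graph B = sv_graph A)"

definition disjointly_injective :: "'a svmap \<Rightarrow> bool"
  where "disjointly_injective A \<longleftrightarrow> (\<forall>x y. x \<noteq> y \<longrightarrow> A x \<inter> A y = {})"

definition resolvent_average ::
  "real \<Rightarrow> 'i set \<Rightarrow> ('i \<Rightarrow> 'a::real_vector svmap) \<Rightarrow> ('i \<Rightarrow> real) \<Rightarrow> 'a svmap"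
  where "resolvent_average \<mu> I A lam =
    sv_minus
      (sv_inverse
        (sv_sum
          (\<lambda>i. sv_scale (lam i) (sv_inverse (sv_plus (A i) (sv_scale (inverse \<mu>) sv_id)))) I))
      (sv_scale (inverse \<mu>) sv_id)"

end

theory Submission
  imports Defs
begin

text \<open>
  Put \<open>c = \<mu>\<^sup>-\<^sup>1\<close> and suppose that \<open>u\<close> is a value of the resolvent average both at \<open>x\<close> and at
  \<open>y\<close>. Unfolding the definition gives \<open>x = \<Sum>i. \<lambda>\<^sub>i a\<^sub>i\<close> and \<open>y = \<Sum>i. \<lambda>\<^sub>i b\<^sub>i\<close> with
  \<open>u + c (x - a\<^sub>i) \<in> A\<^sub>i a\<^sub>i\<close> and \<open>u + c (y - b\<^sub>i) \<in> A\<^sub>i b\<^sub>i\<close>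
  (lemma \<open>mem_resolvent_average_iff\<close>). Write \<open>d\<^sub>i = a\<^sub>i - b\<^sub>i\<close> and
  \<open>d = x - y = \<Sum>i. \<lambda>\<^sub>i d\<^sub>i\<close>. Monotonicity of \<open>A\<^sub>i\<close> says \<open>\<langle>d\<^sub>i, d - d\<^sub>i\<rangle> \<ge> 0\<close>; averaging and
  using that \<open>\<Sum>i. \<lambda>\<^sub>i \<parallel>d\<^sub>i - d\<parallel>\<^sup>2 = - \<Sum>i. \<lambda>\<^sub>i \<langle>d\<^sub>i, d - d\<^sub>i\<rangle>\<close> forces \<open>d\<^sub>i = d\<close> for all \<open>i\<close>
  (lemma \<open>eq_convex_combination_if_inner_nonneg\<close>). Then \<open>x - a\<^sub>i = y - b\<^sub>i\<close>, so \<open>A\<^sub>i a\<^sub>i\<close> and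
  \<open>A\<^sub>i b\<^sub>i\<close> share a point for every \<open>i\<close>. If one \<open>A\<^sub>i\<close> is disjointly injective, \<open>a\<^sub>i = b\<^sub>i\<close> for
  that \<open>i\<close>, hence \<open>d = 0\<close> and \<open>x = y\<close>.
\<close>

text \<open>
  A value \<open>u\<close> at \<open>x\<close> corresponds to the single point \<open>u + \<mu>\<^sup>-\<^sup>1 x\<close> at which all the resolvents
  \<open>(A\<^sub>i + \<mu>\<^sup>-\<^sup>1 Id)\<^sup>-\<^sup>1\<close> are evaluated; \<open>a\<^sub>i\<close> is the value of the \<open>i\<close>-th one that contributes to \<open>x\<close>.
\<close>

lemma mem_resolvent_average_iff:
  fixes A :: "'i \<Rightarrow> 'a::real_vector svmap"
  assumes "finite I"
  shows "u \<in> resolvent_average \<mu> I A lam x \<longleftrightarrow>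
    (\<exists>a. x = (\<Sum>i\<in>I. lam i *\<^sub>R a i) \<and>
         (\<forall>i\<in>I. u + inverse \<mu> *\<^sub>R (x - a i) \<in> A i (a i)))"
proof -
  define c where "c = inverse \<mu>"
  have resolvent: "a \<in> sv_inverse (sv_plus (A i) (sv_scale c sv_id)) (u + c *\<^sub>R x) \<longleftrightarrow>
      u + c *\<^sub>R (x - a) \<in> A i a" for a i
  proof -
    have "u + c *\<^sub>R x = v + c *\<^sub>R a \<longleftrightarrow> v = u + c *\<^sub>R (x - a)" for v
      by (auto simp: algebra_simps)
    then show ?thesis
      by (simp add: sv_inverse_def sv_plus_def sv_scale_def sv_id_def set_plus_def)
  qed
  have "u \<in> resolvent_average \<mu> I A lam x \<longleftrightarrow>
      x \<in> (\<Sum>i\<in>I. (*\<^sub>R) (lam i) `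
             sv_inverse (sv_plus (A i) (sv_scale c sv_id)) (u + c *\<^sub>R x))"
  proof -
    have "u = w + - (c *\<^sub>R x) \<longleftrightarrow> w = u + c *\<^sub>R x" for w
      by (auto simp: algebra_simps)
    then show ?thesis
      unfolding resolvent_average_def c_def[symmetric] sv_minus_def
      by (subst sv_plus_def, subst sv_inverse_def)
         (simp add: sv_sum_def sv_scale_def sv_id_def set_plus_def)
  qed
  also have "\<dots> \<longleftrightarrow> (\<exists>s. x = sum s I \<and>
      (\<forall>i\<in>I. \<exists>a. s i = lam i *\<^sub>R a \<and> u + c *\<^sub>R (x - a) \<in> A i a))"
  proof -
    have "s \<in> (*\<^sub>R) (lam i) ` sv_inverse (sv_plus (A i) (sv_scale c sv_id)) (u + c *\<^sub>R x) \<longleftrightarrow>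
        (\<exists>a. s = lam i *\<^sub>R a \<and> u + c *\<^sub>R (x - a) \<in> A i a)" for s i
      unfolding image_iff Bex_def resolvent by blast
    then show ?thesis
      unfolding set_sum_alt[OF assms] by simp
  qed
  also have "\<dots> \<longleftrightarrow> (\<exists>a. x = (\<Sum>i\<in>I. lam i *\<^sub>R a i) \<and>
      (\<forall>i\<in>I. u + c *\<^sub>R (x - a i) \<in> A i (a i)))"
  proof
    assume "\<exists>s. x = sum s I \<and>
      (\<forall>i\<in>I. \<exists>a. s i = lam i *\<^sub>R a \<and> u + c *\<^sub>R (x - a) \<in> A i a)"
    then obtain s a where "x = sum s I"
      and "\<forall>i\<in>I. s i = lam i *\<^sub>R a i \<and> u + c *\<^sub>R (x - a i) \<in> A i (a i)"
      by metis
    then show "\<exists>a. x = (\<Sum>i\<in>I. lam i *\<^sub>R a i) \<and>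
        (\<forall>i\<in>I. u + c *\<^sub>R (x - a i) \<in> A i (a i))"
      by (intro exI[of _ a]) auto
  next
    assume "\<exists>a. x = (\<Sum>i\<in>I. lam i *\<^sub>R a i) \<and>
        (\<forall>i\<in>I. u + c *\<^sub>R (x - a i) \<in> A i (a i))"
    then obtain a where "x = (\<Sum>i\<in>I. lam i *\<^sub>R a i)"
      and "\<forall>i\<in>I. u + c *\<^sub>R (x - a i) \<in> A i (a i)"
      by blast
    then show "\<exists>s. x = sum s I \<and>
        (\<forall>i\<in>I. \<exists>a. s i = lam i *\<^sub>R a \<and> u + c *\<^sub>R (x - a) \<in> A i a)"
      by (intro exI[of _ "\<lambda>i. lam i *\<^sub>R a i"]) blast
  qed
  finally show ?thesis
    unfolding c_def .
qed

text \<open>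
  The equality case of \<open>\<parallel>m\<parallel>\<^sup>2 \<le> \<Sum>i. \<lambda>\<^sub>i \<parallel>d\<^sub>i\<parallel>\<^sup>2\<close>: the hypothesis on inner products gives the
  reverse inequality, so all the points that are averaged coincide with their average.
\<close>

lemma eq_convex_combination_if_inner_nonneg:
  fixes d :: "'i \<Rightarrow> 'a::real_inner"
  assumes fin: "finite I"
    and pos: "\<And>i. i \<in> I \<Longrightarrow> lam i > 0"
    and sum1: "(\<Sum>i\<in>I. lam i) = 1"
    and m: "m = (\<Sum>i\<in>I. lam i *\<^sub>R d i)"
    and nonneg: "\<And>i. i \<in> I \<Longrightarrow> inner (d i) (m - d i) \<ge> 0"
    and j: "j \<in> I"
  shows "d j = m"
proof -
  have "(\<Sum>i\<in>I. lam i *\<^sub>R (m - d i)) = 0"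
    by (simp add: scaleR_diff_right sum_subtractf m[symmetric] sum1
        flip: scaleR_sum_left)
  then have mean: "(\<Sum>i\<in>I. lam i * inner m (m - d i)) = 0"
    by (simp flip: inner_scaleR_right inner_sum_right)
  have "(\<Sum>i\<in>I. lam i * (norm (m - d i))\<^sup>2) =
      (\<Sum>i\<in>I. lam i * inner m (m - d i)) - (\<Sum>i\<in>I. lam i * inner (d i) (m - d i))"
    by (simp add: power2_norm_eq_inner inner_diff_left right_diff_distrib
        flip: sum_subtractf)
  also have "\<dots> \<le> 0"
    using mean by (simp add: sum_nonneg pos nonneg less_imp_le)
  finally have "(\<Sum>i\<in>I. lam i * (norm (m - d i))\<^sup>2) = 0"
    by (intro antisym sum_nonneg) (auto simp: pos less_imp_le)
  then have "lam j * (norm (m - d j))\<^sup>2 = 0"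
    using fin j by (subst (asm) sum_nonneg_eq_0_iff) (auto simp: pos less_imp_le)
  then show ?thesis
    using pos[OF j] by simp
qed

lemma sv_monotoneD:
  assumes "sv_monotone A" "u \<in> A x" "v \<in> A y"
  shows "inner (x - y) (u - v) \<ge> 0"
  using assms unfolding sv_monotone_def sv_graph_def by fastforce

lemma disjointly_injective_resolvent_average:
  fixes A :: "'i \<Rightarrow> 'a::real_inner svmap"
  assumes \<mu>: "\<mu> > 0"
    and fin: "finite I"
    and pos: "\<And>i. i \<in> I \<Longrightarrow> lam i > 0"
    and sum1: "(\<Sum>i\<in>I. lam i) = 1"
    and mono: "\<And>i. i \<in> I \<Longrightarrow> sv_monotone (A i)"
    and j: "j \<in> I"
    and inj: "disjointly_injective (A j)"
  shows "disjointly_injective (resolvent_average \<mu> I A lam)"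
proof -
  define c where "c = inverse \<mu>"
  have c: "c > 0"
    using \<mu> by (simp add: c_def)
  have "x = y"
    if ux: "u \<in> resolvent_average \<mu> I A lam x" and uy: "u \<in> resolvent_average \<mu> I A lam y"
    for u x y
  proof -
    obtain a where a: "x = (\<Sum>i\<in>I. lam i *\<^sub>R a i)"
      and ua: "\<And>i. i \<in> I \<Longrightarrow> u + c *\<^sub>R (x - a i) \<in> A i (a i)"
      using ux unfolding mem_resolvent_average_iff[OF fin] c_def by blast
    obtain b where b: "y = (\<Sum>i\<in>I. lam i *\<^sub>R b i)"
      and ub: "\<And>i. i \<in> I \<Longrightarrow> u + c *\<^sub>R (y - b i) \<in> A i (b i)"
      using uy unfolding mem_resolvent_average_iff[OF fin] c_def by blast
    have "inner (a i - b i) ((x - y) - (a i - b i)) \<ge> 0" if i: "i \<in> I" for i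
    proof -
      have "u + c *\<^sub>R (x - a i) - (u + c *\<^sub>R (y - b i)) = c *\<^sub>R ((x - y) - (a i - b i))"
        by (simp add: algebra_simps)
      then have "c * inner (a i - b i) ((x - y) - (a i - b i)) \<ge> 0"
        using sv_monotoneD[OF mono[OF i] ua[OF i] ub[OF i]] by (metis inner_scaleR_right)
      then show ?thesis
        using c by (simp add: zero_le_mult_iff)
    qed
    moreover have "x - y = (\<Sum>i\<in>I. lam i *\<^sub>R (a i - b i))"
      by (simp add: a b scaleR_diff_right sum_subtractf)
    ultimately have diff: "a j - b j = x - y"
      using eq_convex_combination_if_inner_nonneg[OF fin pos sum1, where d = "\<lambda>i. a i - b i"] j
      by blast
    then have "x - a j = y - b j"
      by (simp add: algebra_simps)
    then have "u + c *\<^sub>R (x - a j) \<in> A j (a j) \<inter> A j (b j)"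
      using ua[OF j] ub[OF j] by simp
    then have "a j = b j"
      using inj unfolding disjointly_injective_def by blast
    then show "x = y"
      using diff by simp
  qed
  then show ?thesis
    unfolding disjointly_injective_def by blast
qed

theorem theorem3p30:
  fixes \<mu> :: real
    and n :: nat
    and lam :: "nat \<Rightarrow> real"
    and A :: "nat \<Rightarrow> 'a::{real_inner, complete_space} svmap"
  assumes "\<mu> > 0"
    and "n \<ge> 1"
    and "\<And>i. i \<in> {1..n} \<Longrightarrow> lam i > 0"
    and "(\<Sum>i\<in>{1..n}. lam i) = 1"
    and "\<And>i. i \<in> {1..n} \<Longrightarrow> maximally_monotone (A i)"
    and "\<exists>i0\<in>{1..n}. disjointly_injective (A i0)"
  shows "disjointly_injective (resolvent_average \<mu> {1..n} A lam)"
proof -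
  obtain j where "j \<in> {1..n}" "disjointly_injective (A j)"
    using assms(6) by blast
  moreover have "sv_monotone (A i)" if "i \<in> {1..n}" for i
    using assms(5)[OF that] by (simp add: maximally_monotone_def)
  ultimately show ?thesis
    using assms(1,3,4)
    by (intro disjointly_injective_resolvent_average[where j = j]) auto
qed

end
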